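(* Let $(\mathcal{M},g)$ be a $C^\infty$ pseudo-Riemannian manifold of dimension $n$ and signature $(q,n-q)$, and fix a non-negative integer $k$. Assume that the algebraic structure of the curvature tensors does not change over the neighbourhood under consideration. Let $p\in\mathcal{M}$ be a point of this neighbourhood. For an orthonormal frame $\omega=\{\mathbf{e}_1,\dots,\mathbf{e}_n\}$ at $p$, let $X_\omega=[R_{abcd},R_{abcd;e},\dots,R_{abcd;e_1\dots e_k}]\in\mathbb{R}^m$ be the tuple of frame components of the Riemann tensor and its covariant derivatives up to order $k$ at $p$. Then either: (1) $X_\omega$ is characterised by its invariants; or (2) for every $\epsilon>0$ there exist an orthonormal frame $\omega$ at $p$ and a vector $\tilde{X}_\omega\in\mathbb{R}^m$ such that $X_\omega=\tilde{X}_\omega+N_\omega$ with $\|N_\omega\|<\epsilon$, where $\tilde{X}_\omega$ is characterised by its invariants, and every polynomial invariant takes the same value on $\tilde{X}_\omega$ as on $X_\omega$.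
   Context: The group $G=O(q,n-q)$ acts on orthonormal frames at $p$: for $g=(M^a_{~b})$, $g\omega=\{M^a_{~1}\mathbf{e}_a,\dots,M^a_{~n}\mathbf{e}_a\}$. This induces a linear action on $\mathbb{R}^m$ through the tensor structure of the components: each tensor component block $R^{(i)}_{a_1\dots a_{k_i}}$ is mapped to $M^{b_1}_{~a_1}\cdots M^{b_{k_i}}_{~a_{k_i}}R^{(i)}_{b_1\dots b_{k_i}}$, so that $X_{g\omega}=g(X_\omega)$. (The components in $X_\omega$ need not be independent; their order is irrelevant.) The orbit of $X\in\mathbb{R}^m$ is $\mathcal{O}(X)=\{g(X): g\in G\}$. A vector $X\in\mathbb{R}^m$ is said to be \emph{characterised by its invariants} if its orbit $\mathcal{O}(X)$ is topologically closed in $\mathbb{R}^m$ (equivalently, its orbit under the complexified group $O(n,\mathbb{C})$ acting on $\mathbb{C}^m$ is closed). A polynomial invariant is a polynomial function $I:\mathbb{R}^m\to\mathbb{R}$ with $I(g(X))=I(X)$ for all $g\in G$. $\|\cdot\|$ denotes the standard Euclidean norm on $\mathbb{R}^m$ (which is $O(q)\times O(n-q)$-invariant). *)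

theory Defs
  imports "HOL-Analysis.Analysis"
begin

text \<open>Frame components of a tuple of tensors. Block i (i < length ks) is a tensor
  of rank ks!i; its component with frame indices a_1..a_k is X i [a_1,...,a_k].
  Frame indices range over the finite type 'n (so n = CARD('n)).\<close>

type_synonym 'n tdata = "nat \<Rightarrow> 'n list \<Rightarrow> real"

definition idx_lists :: "nat \<Rightarrow> 'n::finite list set" where
  "idx_lists k = {l. length l = k}"

definition tspace :: "nat list \<Rightarrow> ('n::finite) tdata set" where
  "tspace ks = {X. \<forall>i l. (i \<ge> length ks \<or> length l \<noteq> ks ! i) \<longrightarrow> X i l = 0}"

definition tnorm :: "nat list \<Rightarrow> ('n::finite) tdata \<Rightarrow> real" where
  "tnorm ks X = sqrt (\<Sum>i<length ks. \<Sum>l\<in>idx_lists (ks ! i). (X i l)\<^sup>2)"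

text \<open>Orthonormal-frame metric of signature (q, n-q): S is the set of the q
  indices with negative norm.\<close>
definition eta :: "'n set \<Rightarrow> real^'n^'n" where
  "eta S = (\<chi> a b. if a = b then (if a \<in> S then -1 else 1) else 0)"

text \<open>The group O(q,n-q); M $ a $ b is M^a_b, new frame e'_b = M^a_b e_a.\<close>
definition Ogroup :: "'n::finite set \<Rightarrow> (real^'n^'n) set" where
  "Ogroup S = {M. transpose M ** eta S ** M = eta S}"

definition act :: "nat list \<Rightarrow> real^'n^'n \<Rightarrow> ('n::finite) tdata \<Rightarrow> 'n tdata" where
  "act ks M X = (\<lambda>i as. if i < length ks \<and> length as = ks ! i then
      (\<Sum>bs\<in>idx_lists (ks ! i). (\<Prod>j<ks ! i. M $ (bs ! j) $ (as ! j)) * X i bs)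
    else 0)"

definition orbit :: "nat list \<Rightarrow> 'n set \<Rightarrow> ('n::finite) tdata \<Rightarrow> 'n tdata set" where
  "orbit ks S X = {act ks M X | M. M \<in> Ogroup S}"

definition closed_in_tspace :: "nat list \<Rightarrow> ('n::finite) tdata set \<Rightarrow> bool" where
  "closed_in_tspace ks A \<longleftrightarrow>
     (\<forall>f Y. (\<forall>j. f j \<in> A) \<and> Y \<in> tspace ks \<and>
            ((\<lambda>j. tnorm ks (\<lambda>i l. f j i l - Y i l)) \<longlonglongrightarrow> 0) \<longrightarrow> Y \<in> A)"

definition char_by_invariants :: "nat list \<Rightarrow> 'n set \<Rightarrow> ('n::finite) tdata \<Rightarrow> bool" where
  "char_by_invariants ks S X \<longleftrightarrow> closed_in_tspace ks (orbit ks S X)"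

inductive_set poly_fun :: "nat list \<Rightarrow> (('n::finite) tdata \<Rightarrow> real) set" for ks where
  const: "(\<lambda>X. c) \<in> poly_fun ks"
| coord: "i < length ks \<Longrightarrow> length l = ks ! i \<Longrightarrow> (\<lambda>X. X i l) \<in> poly_fun ks"
| add: "p \<in> poly_fun ks \<Longrightarrow> q \<in> poly_fun ks \<Longrightarrow> (\<lambda>X. p X + q X) \<in> poly_fun ks"
| mult: "p \<in> poly_fun ks \<Longrightarrow> q \<in> poly_fun ks \<Longrightarrow> (\<lambda>X. p X * q X) \<in> poly_fun ks"

definition poly_invariants :: "nat list \<Rightarrow> 'n set \<Rightarrow> (('n::finite) tdata \<Rightarrow> real) set" where
  "poly_invariants ks S = {I \<in> poly_fun ks. \<forall>M\<in>Ogroup S. \<forall>X\<in>tspace ks. I (act ks M X) = I X}"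

text \<open>Ranks of R_{abcd}, R_{abcd;e}, ..., R_{abcd;e_1..e_k}.\<close>
definition curv_ranks :: "nat \<Rightarrow> nat list" where
  "curv_ranks k = map (\<lambda>j. 4 + j) [0..<Suc k]"

end

theory Submission
  imports Defs
begin

text \<open>The limit \<open>Y\<close> of a norm-minimising sequence in the orbit of \<open>X\<close> is a minimal vector: no group
  element shortens it. Polynomial invariants are continuous, so they agree on \<open>Y\<close> and on the orbit
  of \<open>X\<close>; it remains to see that orbits of minimal vectors \<open>v\<close> are closed (Kempf--Ness). If \<open>g\<^sub>j v\<close>
  converges, choose each \<open>g\<^sub>j\<close> of least Frobenius norm among the group elements with the same value
  on \<open>v\<close>. Were the \<open>g\<^sub>j\<close> unbounded, their Cartan decompositions would have a limiting direction along
  which \<open>v\<close> stays bounded. By minimality that one-parameter group fixes \<open>v\<close>, and moving backwards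
  along it shortens \<open>g\<^sub>j\<close>, a contradiction. So a subsequence of the \<open>g\<^sub>j\<close> converges in the group.

  Note that \<open>act\<close> is a right action, so orders of matrix products are reversed.\<close>

section \<open>Orthogonal diagonalisation\<close>

text \<open>First-order optimality. The quadratic form \<open>q\<close> is nonnegative on
  \<open>V\<close> and vanishes at \<open>x\<close>. Moving from \<open>x\<close> by
  \<open>- r *\<^sub>R y\<close>, where \<open>y\<close> measures the failure of the eigenvector
  equation, changes \<open>q\<close> to first order by \<open>- 2 * r * (y \<bullet> y)\<close>, so
  \<open>y\<close> must be 0.\<close>

lemma self_adjoint_maximiser_eigenvector:
  fixes f :: "'a::real_inner \<Rightarrow> 'a"
  assumes f: "linear f" and sym: "\<And>x y. f x \<bullet> y = x \<bullet> f y"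
    and V: "subspace V" "f ` V \<subseteq> V" and x: "x \<in> V" "norm x = 1"
    and max: "\<And>z. z \<in> V \<Longrightarrow> norm z = 1 \<Longrightarrow> z \<bullet> f z \<le> x \<bullet> f x"
  shows "f x = (x \<bullet> f x) *\<^sub>R x"
proof -
  define m where "m = x \<bullet> f x"
  define q where "q z = m * (z \<bullet> z) - z \<bullet> f z" for z
  define y where "y = m *\<^sub>R x - f x"
  have q_nonneg: "q z \<ge> 0" if "z \<in> V" for z
  proof (cases "z = 0")
    case False
    define u where "u = z /\<^sub>R norm z"
    have u: "u \<in> V" "norm u = 1" "z = norm z *\<^sub>R u"
      using V(1) that False by (auto simp: u_def subspace_scale)
    have "u \<bullet> f u \<le> m" using max[OF u(1,2)] by (simp add: m_def)
    moreover have "z \<bullet> f z = (norm z)\<^sup>2 * (u \<bullet> f u)"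
      by (subst (1 2) u(3)) (simp add: linear_scale[OF f] power2_eq_square)
    ultimately have "z \<bullet> f z \<le> (norm z)\<^sup>2 * m"
      by (metis mult_left_mono zero_le_power2)
    then show ?thesis by (simp add: q_def power2_norm_eq_inner mult.commute)
  qed (simp add: q_def linear_0[OF f])
  have "y \<in> V" using V x by (auto simp: y_def intro!: subspace_diff subspace_scale)
  have xx: "x \<bullet> x = 1" using x(2) by (simp add: norm_eq_1)
  have q_expand: "q (x - r *\<^sub>R y) = r\<^sup>2 * q y - 2 * r * (y \<bullet> y)" for r
  proof -
    have yf: "y \<bullet> f x = m * (x \<bullet> y) - y \<bullet> y"
      by (subst (3) y_def) (simp add: inner_diff_right inner_commute)
    have xf: "x \<bullet> f y = m * (x \<bullet> y) - y \<bullet> y"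
      using sym[of x y] yf by (simp add: inner_commute)
    show ?thesis
      by (simp add: yf xf inner_commute[of y x] q_def linear_diff[OF f] linear_scale[OF f] inner_diff_left inner_diff_right
          xx m_def[symmetric] power2_eq_square algebra_simps)
  qed
  have "y \<bullet> y = 0"
  proof (rule ccontr)
    assume "y \<bullet> y \<noteq> 0"
    then have pos: "y \<bullet> y > 0" by simp
    have qy: "q y \<ge> 0" using q_nonneg \<open>y \<in> V\<close> by auto
    \<comment> \<open>Small enough that the quadratic term \<open>r\<^sup>2 * q y\<close> cannot
      compensate the linear one; the summand 1 keeps the denominator positive when
      \<open>q y = 0\<close>.\<close>
    define r where "r = (y \<bullet> y) / (q y + 1)"
    have r: "r > 0" using pos qy by (simp add: r_def)
    have "x - r *\<^sub>R y \<in> V" using V x \<open>y \<in> V\<close> by (auto intro!: subspace_diff subspace_scale)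
    then have "0 \<le> r * (r * q y - 2 * (y \<bullet> y))"
      using q_nonneg q_expand[of r] by (force simp: power2_eq_square algebra_simps)
    then have "2 * (y \<bullet> y) \<le> r * q y" using r by (simp add: zero_le_mult_iff)
    also have "\<dots> \<le> r * (q y + 1)" using r by simp
    also have "\<dots> = y \<bullet> y" using qy by (simp add: r_def)
    finally show False using pos by simp
  qed
  then show ?thesis by (simp add: y_def m_def)
qed

text \<open>Induction on the dimension. The Rayleigh quotient attains its maximum on the compact
  unit sphere of \<open>V\<close>, which yields one eigenvector \<open>x\<close>; self-adjointness
  makes the orthogonal complement \<open>W\<close> of \<open>x\<close> in \<open>V\<close> invariant
  again.\<close>

lemma self_adjoint_orthonormal_eigenvectors:
  fixes f :: "'a::euclidean_space \<Rightarrow> 'a"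
  assumes f: "linear f" and sym: "\<And>x y. f x \<bullet> y = x \<bullet> f y"
    and V: "subspace V" "f ` V \<subseteq> V"
  shows "\<exists>B\<subseteq>V. pairwise orthogonal B \<and> (\<forall>x\<in>B. norm x = 1 \<and> (\<exists>c. f x = c *\<^sub>R x)) \<and> span B = V"
  using V
proof (induction "dim V" arbitrary: V rule: less_induct)
  case less
  show ?case
  proof (cases "V = {0}")
    case True
    then show ?thesis by (intro exI[of _ "{}"]) auto
  next
    case False
    then obtain v where v: "v \<in> V" "v \<noteq> 0" using subspace_0[OF less.prems(1)] by auto
    define K where "K = sphere 0 1 \<inter> V"
    have "compact K" by (simp add: K_def compact_Int_closed closed_subspace less.prems)
    moreover have "v /\<^sub>R norm v \<in> K" using v less.prems by (auto simp: K_def subspace_scale)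
    moreover have "continuous_on K (\<lambda>z. z \<bullet> f z)"
      by (intro continuous_intros linear_continuous_on linear_conv_bounded_linear[THEN iffD1] f)
    ultimately obtain x where x: "x \<in> K" and max: "\<And>z. z \<in> K \<Longrightarrow> z \<bullet> f z \<le> x \<bullet> f x"
      using continuous_attains_sup[of K "\<lambda>z. z \<bullet> f z"] by blast
    define m where "m = x \<bullet> f x"
    have fx: "f x = m *\<^sub>R x"
      unfolding m_def
      by (rule self_adjoint_maximiser_eigenvector[OF f sym less.prems])
        (use x max in \<open>auto simp: K_def\<close>)
    have xV: "x \<in> V" and xx: "x \<bullet> x = 1" using x by (auto simp: K_def norm_eq_1)
    define W where "W = {y \<in> V. x \<bullet> y = 0}"
    have W: "subspace W"
      using less.prems(1) by (auto simp: W_def subspace_def inner_add_right)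
    have fW: "f ` W \<subseteq> W"
      using less.prems(2) by (auto simp: W_def sym[symmetric] fx)
    have "x \<notin> W" using xx by (simp add: W_def)
    moreover have "W \<subseteq> V" by (auto simp: W_def)
    ultimately have "W \<subset> V" using xV by blast
    then have "dim W < dim V"
      by (intro dim_psubset) (simp add: span_eq_iff[THEN iffD2, OF W] span_eq_iff[THEN iffD2, OF less.prems(1)])
    from less.hyps[OF this W fW] obtain B where B: "B \<subseteq> W" "pairwise orthogonal B"
      "\<And>x. x \<in> B \<Longrightarrow> norm x = 1 \<and> (\<exists>c. f x = c *\<^sub>R x)" "span B = W" by auto
    have "V \<subseteq> span (insert x B)"
    proof
      fix w assume "w \<in> V"
      then have "w - (x \<bullet> w) *\<^sub>R x \<in> W"
        using xV xx less.prems(1) by (auto simp: W_def subspace_diff subspace_scale inner_diff_right)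
      then show "w \<in> span (insert x B)"
        using B(4) by (auto simp: span_insert)
    qed
    moreover have "span (insert x B) \<subseteq> V"
      using B(1) xV less.prems(1) by (intro span_minimal) (auto simp: W_def)
    moreover have "pairwise orthogonal (insert x B)"
      using B(1,2) by (auto simp: pairwise_insert orthogonal_def W_def inner_commute)
    ultimately show ?thesis
      using B(1,3) xV xx fx by (intro exI[of _ "insert x B"]) (auto simp: W_def norm_eq_1)
  qed
qed

definition diag :: "real^'n \<Rightarrow> real^'n^'n" where
  "diag d = (\<chi> a b. if a = b then d $ a else 0)"

lemma diag_mult_left: "(diag d ** A) $ a $ b = d $ a * A $ a $ b"
  by (simp add: diag_def matrix_matrix_mult_def if_distrib[of "\<lambda>x. x * _"] cong: if_cong)

lemma diag_mult_right: "(A ** diag d) $ a $ b = A $ a $ b * d $ b"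
  by (simp add: diag_def matrix_matrix_mult_def if_distrib[of "\<lambda>x. _ * x"] cong: if_cong)

lemma transpose_diag [simp]: "transpose (diag d) = diag d"
  by (auto simp: diag_def transpose_def vec_eq_iff)

text \<open>An orthonormal eigenbasis has exactly as many elements as the index type, so it can be
  enumerated by that type and used as the columns of \<open>U\<close>.\<close>

lemma symmetric_matrix_diagonalisable:
  fixes A :: "real^'n^'n"
  assumes "transpose A = A"
  obtains U d where "orthogonal_matrix U" "A ** U = U ** diag d"
proof -
  have "(A *v x) \<bullet> y = x \<bullet> (A *v y)" for x y
    using assms by (metis dot_lmul_matrix vector_transpose_matrix)
  then obtain B where B: "pairwise orthogonal B"
      "\<And>x. x \<in> B \<Longrightarrow> norm x = 1 \<and> (\<exists>c. A *v x = c *\<^sub>R x)" "span B = UNIV"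
    using self_adjoint_orthonormal_eigenvectors[of "(*v) A" UNIV] by auto
  have "0 \<notin> B" using B(2) by force
  then have "independent B" using B(1) pairwise_orthogonal_independent by blast
  then have "finite B" "card B = CARD('n)"
    using B(3) dim_eq_card[of B UNIV] by (auto simp: independent_imp_finite)
  then obtain u where u: "bij_betw u (UNIV :: 'n set) B"
    using finite_same_card_bij[of "UNIV :: 'n set" B] by auto
  define U :: "real^'n^'n" where "U = (\<chi> a b. u b $ a)"
  have col: "column b U = u b" for b by (simp add: column_def U_def vec_eq_iff)
  have uB: "u b \<in> B" for b using u by (auto simp: bij_betw_def)
  have "orthogonal_matrix U"
    unfolding orthogonal_matrix_orthonormal_columns col
    using uB B(1,2) u by (auto simp: pairwise_def bij_betw_def inj_on_def) metis
  moreover obtain c where c: "\<And>b. A *v u b = c b *\<^sub>R u b" using B(2)[OF uB] by metis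
  have "A ** U = U ** diag (\<chi> b. c b)"
  proof (intro vec_eq_iff[THEN iffD2] allI)
    fix a b
    have "(A ** U) $ a $ b = (A *v u b) $ a"
      by (simp add: matrix_matrix_mult_def matrix_vector_mult_def U_def)
    then show "(A ** U) $ a $ b = (U ** diag (\<chi> b. c b)) $ a $ b"
      by (simp add: c diag_mult_right) (simp add: U_def)
  qed
  ultimately show ?thesis using that by blast
qed

section \<open>Frobenius norm and limits of matrices\<close>

lemma power2_norm_matrix:
  fixes A :: "real^'n^'m"
  shows "(norm A)\<^sup>2 = (\<Sum>a\<in>UNIV. \<Sum>b\<in>UNIV. (A $ a $ b)\<^sup>2)"
  by (simp add: norm_vec_def L2_set_def sum_nonneg)

text \<open>The squared Frobenius norm is the trace of \<open>transpose B ** B\<close>, and a left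
  orthogonal factor cancels in this product.\<close>

lemma norm_orthogonal_matrix_mult:
  fixes A :: "real^'n^'m" and Q :: "real^'m^'m"
  assumes "transpose Q ** Q = mat 1"
  shows "norm (Q ** A) = norm A"
proof -
  have tr: "(norm B)\<^sup>2 = trace (transpose B ** B)" for B :: "real^'n^'m"
    unfolding power2_norm_matrix trace_def
    by (subst sum.swap) (simp add: matrix_matrix_mult_def transpose_def power2_eq_square)
  have "transpose (Q ** A) ** (Q ** A) = transpose A ** A"
    by (metis assms matrix_mul_assoc matrix_mul_lid matrix_transpose_mul)
  then have "(norm (Q ** A))\<^sup>2 = (norm A)\<^sup>2" by (simp add: tr)
  then show ?thesis by simp
qed

lemma norm_transpose_matrix: "norm (transpose A) = norm (A :: real^'n^'m)"
proof -
  have "(norm (transpose A))\<^sup>2 = (norm A)\<^sup>2"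
    unfolding power2_norm_matrix by (simp add: transpose_def) (rule sum.swap)
  then show ?thesis by simp
qed

lemma norm_mult_orthogonal_matrix:
  fixes A :: "real^'n^'m" and Q :: "real^'n^'n"
  assumes "Q ** transpose Q = mat 1"
  shows "norm (A ** Q) = norm A"
  using norm_orthogonal_matrix_mult[of "transpose Q" "transpose A"] assms
  by (metis matrix_transpose_mul norm_transpose_matrix transpose_transpose)

lemma tendsto_matrix_mult [tendsto_intros]:
  fixes A :: "'a \<Rightarrow> real^'n^'m" and B :: "'a \<Rightarrow> real^'p^'n"
  assumes "(A \<longlongrightarrow> A0) F" "(B \<longlongrightarrow> B0) F"
  shows "((\<lambda>x. A x ** B x) \<longlongrightarrow> A0 ** B0) F"
  unfolding matrix_matrix_mult_def
  by (intro vec_tendstoI) (auto intro!: tendsto_intros assms)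

lemma tendsto_transpose [tendsto_intros]:
  fixes A :: "'a \<Rightarrow> real^'n^'m"
  assumes "(A \<longlongrightarrow> A0) F"
  shows "((\<lambda>x. transpose (A x)) \<longlongrightarrow> transpose A0) F"
  unfolding transpose_def by (intro vec_tendstoI) (auto intro!: tendsto_intros assms)

section \<open>The tensor representation\<close>

lemma in_idx_lists_iff [simp]: "l \<in> idx_lists k \<longleftrightarrow> length l = k"
  by (simp add: idx_lists_def)

lemma idx_lists_0: "idx_lists 0 = {[]}"
  by (auto simp: idx_lists_def)

lemma idx_lists_Suc: "idx_lists (Suc k) = (\<lambda>(a, l). a # l) ` (UNIV \<times> idx_lists k)"
  by (auto simp: idx_lists_def length_Suc_conv image_iff)

lemma finite_idx_lists [simp]: "finite (idx_lists k :: 'n::finite list set)"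
  by (induction k) (auto simp: idx_lists_0 idx_lists_Suc)

text \<open>Distributivity over all index lists. It makes the tensor powers of matrices
  multiplicative in \<open>act_act\<close>.\<close>

lemma sum_prod_idx_lists:
  fixes f :: "nat \<Rightarrow> 'n::finite \<Rightarrow> real"
  shows "(\<Sum>l\<in>idx_lists k. \<Prod>j<k. f j (l ! j)) = (\<Prod>j<k. \<Sum>b\<in>UNIV. f j b)"
proof (induction k arbitrary: f)
  case 0
  then show ?case by (simp add: idx_lists_0)
next
  case (Suc k)
  have "inj_on (\<lambda>(a, l). a # l) (UNIV \<times> idx_lists k :: ('n \<times> 'n list) set)"
    by (auto simp: inj_on_def)
  then have "(\<Sum>l\<in>idx_lists (Suc k). \<Prod>j<Suc k. f j (l ! j)) =
      (\<Sum>(a, l)\<in>UNIV \<times> idx_lists k. f 0 a * (\<Prod>j<k. f (Suc j) (l ! j)))"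
    unfolding idx_lists_Suc
    by (subst sum.reindex) (auto simp: prod.lessThan_Suc_shift intro!: sum.cong simp del: prod.lessThan_Suc)
  also have "\<dots> = (\<Sum>a\<in>UNIV. f 0 a) * (\<Prod>j<k. \<Sum>b\<in>UNIV. f (Suc j) b)"
    by (simp add: sum.cartesian_product[symmetric] sum_product[symmetric]
        sum_distrib_left[symmetric] sum_distrib_right[symmetric] Suc.IH[of "\<lambda>j. f (Suc j)"])
  finally show ?case by (simp add: prod.lessThan_Suc_shift del: prod.lessThan_Suc)
qed

lemma act_in_tspace: "act ks M X \<in> tspace ks"
  by (auto simp: act_def tspace_def)

lemma act_act: "act ks M (act ks N X) = act ks (N ** M) X"
proof (intro ext)
  fix i as
  show "act ks M (act ks N X) i as = act ks (N ** M) X i as"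
  proof (cases "i < length ks \<and> length as = ks ! i")
    case True
    define k where "k = ks ! i"
    have "act ks M (act ks N X) i as = (\<Sum>bs\<in>idx_lists k. \<Sum>cs\<in>idx_lists k.
        (\<Prod>j<k. N $ (cs ! j) $ (bs ! j) * M $ (bs ! j) $ (as ! j)) * X i cs)"
      using True
      by (simp add: act_def k_def[symmetric] sum_distrib_left prod.distrib mult_ac)
    also have "\<dots> = (\<Sum>cs\<in>idx_lists k. (\<Sum>bs\<in>idx_lists k.
        \<Prod>j<k. N $ (cs ! j) $ (bs ! j) * M $ (bs ! j) $ (as ! j)) * X i cs)"
      by (subst sum.swap) (simp add: sum_distrib_right)
    also have "\<dots> = act ks (N ** M) X i as"
      using True by (subst sum_prod_idx_lists) (simp add: act_def k_def matrix_matrix_mult_def)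
    finally show ?thesis .
  qed (auto simp: act_def)
qed

text \<open>In the sum over \<open>bs\<close> only \<open>bs = as\<close> survives, since any
  differing slot contributes an off-diagonal zero. Thus the single components are weight vectors for
  the diagonal matrices.\<close>

lemma act_diag:
  assumes "X \<in> tspace ks"
  shows "act ks (diag d) X i as = (\<Prod>j<ks ! i. d $ (as ! j)) * X i as"
proof (cases "i < length ks \<and> length as = ks ! i")
  case True
  define k where "k = ks ! i"
  have prod_diag: "(\<Prod>j<k. diag d $ (bs ! j) $ (as ! j)) = (if bs = as then \<Prod>j<k. d $ (as ! j) else 0)"
    if "bs \<in> idx_lists k" for bs
  proof (cases "bs = as")
    case False
    have "length bs = length as" using that True by (simp add: k_def)
    then have "\<exists>j<k. bs ! j \<noteq> as ! j" using False True nth_equalityI[of bs as] by (auto simp: k_def)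
    then have "\<exists>j\<in>{..<k}. diag d $ (bs ! j) $ (as ! j) = 0" by (auto simp: diag_def)
    then have "(\<Prod>j<k. diag d $ (bs ! j) $ (as ! j)) = 0" by (intro prod_zero) auto
    then show ?thesis using False by simp
  qed (simp add: diag_def)
  have "act ks (diag d) X i as =
      (\<Sum>bs\<in>idx_lists k. (\<Prod>j<k. diag d $ (bs ! j) $ (as ! j)) * X i bs)"
    using True by (simp add: act_def k_def)
  also have "\<dots> = (\<Sum>bs\<in>idx_lists k. if bs = as then (\<Prod>j<k. d $ (as ! j)) * X i as else 0)"
    by (intro sum.cong refl) (simp add: prod_diag)
  also have "\<dots> = (\<Prod>j<k. d $ (as ! j)) * X i as"
    using True by (subst sum.delta) (simp_all add: k_def)
  finally show ?thesis by (simp add: k_def)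
qed (use assms in \<open>auto simp: act_def tspace_def\<close>)

lemma mat_1_eq_diag: "mat 1 = diag 1"
  by (simp add: mat_def diag_def vec_eq_iff)

lemma act_mat_1: "X \<in> tspace ks \<Longrightarrow> act ks (mat 1) X = X"
  unfolding mat_1_eq_diag by (intro ext) (simp add: act_diag)

section \<open>Norm and convergence of component tuples\<close>

definition tindices :: "nat list \<Rightarrow> (nat \<times> 'n::finite list) set" where
  "tindices ks = (SIGMA i:{..<length ks}. idx_lists (ks ! i))"

lemma finite_tindices [simp]: "finite (tindices ks)"
  by (simp add: tindices_def)

lemma tspace_eqI:
  assumes "X \<in> tspace ks" "Y \<in> tspace ks" "\<And>i l. (i, l) \<in> tindices ks \<Longrightarrow> X i l = Y i l"
  shows "X = Y"
proof (intro ext)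
  fix i l
  show "X i l = Y i l"
    using assms by (cases "(i, l) \<in> tindices ks") (auto simp: tspace_def tindices_def)
qed

lemma power2_tnorm: "(tnorm ks X)\<^sup>2 = (\<Sum>(i, l)\<in>tindices ks. (X i l)\<^sup>2)"
proof -
  have "0 \<le> (\<Sum>i<length ks. \<Sum>l\<in>idx_lists (ks ! i). (X i l)\<^sup>2)" by (intro sum_nonneg) simp
  then have "(tnorm ks X)\<^sup>2 = (\<Sum>i<length ks. \<Sum>l\<in>idx_lists (ks ! i). (X i l)\<^sup>2)"
    unfolding tnorm_def by (rule real_sqrt_pow2)
  also have "\<dots> = (\<Sum>(i, l)\<in>tindices ks. (X i l)\<^sup>2)"
    unfolding tindices_def by (rule sum.Sigma) auto
  finally show ?thesis .
qed

lemma tnorm_nonneg [simp]: "0 \<le> tnorm ks X"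
  by (simp add: tnorm_def sum_nonneg)

lemma component_le_tnorm:
  assumes "(i, l) \<in> tindices ks"
  shows "\<bar>X i l\<bar> \<le> tnorm ks X"
proof -
  have "(X i l)\<^sup>2 \<le> (tnorm ks X)\<^sup>2"
    unfolding power2_tnorm
    using member_le_sum[of "(i, l)" "tindices ks" "\<lambda>(i, l). (X i l)\<^sup>2"] assms by auto
  then show ?thesis by (simp add: abs_le_square_iff[symmetric])
qed

text \<open>For the Euclidean inner product the adjoint of \<open>act ks M\<close> is
  \<open>act ks (transpose M)\<close>. As \<open>act\<close> reverses products, applying one after
  the other gives the action of \<open>M ** transpose M\<close>, which is why the hypothesis has
  this order.\<close>

lemma tnorm_act_orthogonal:
  assumes X: "X \<in> tspace ks" and M: "M ** transpose M = mat 1"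
  shows "tnorm ks (act ks M X) = tnorm ks X"
proof -
  have adj: "(\<Sum>(i, l)\<in>tindices ks. act ks N Y i l * Z i l) =
      (\<Sum>(i, l)\<in>tindices ks. Y i l * act ks (transpose N) Z i l)" for N Y Z
  proof -
    have "(\<Sum>(i, l)\<in>tindices ks. act ks N Y i l * Z i l) =
        (\<Sum>i<length ks. \<Sum>l\<in>idx_lists (ks ! i). \<Sum>m\<in>idx_lists (ks ! i).
          (\<Prod>j<ks ! i. N $ (m ! j) $ (l ! j)) * Y i m * Z i l)"
      unfolding tindices_def
      by (subst sum.Sigma[symmetric]) (auto simp: act_def sum_distrib_right intro!: sum.cong)
    also have "\<dots> = (\<Sum>i<length ks. \<Sum>m\<in>idx_lists (ks ! i). \<Sum>l\<in>idx_lists (ks ! i).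
          (\<Prod>j<ks ! i. N $ (m ! j) $ (l ! j)) * Y i m * Z i l)"
      by (intro sum.cong refl sum.swap)
    also have "\<dots> = (\<Sum>(i, l)\<in>tindices ks. Y i l * act ks (transpose N) Z i l)"
      unfolding tindices_def
      by (subst sum.Sigma[symmetric])
        (auto simp: act_def sum_distrib_left transpose_def mult_ac intro!: sum.cong)
    finally show ?thesis .
  qed
  have "(tnorm ks (act ks M X))\<^sup>2 =
      (\<Sum>(i, l)\<in>tindices ks. X i l * act ks (transpose M) (act ks M X) i l)"
    unfolding power2_tnorm unfolding power2_eq_square by (rule adj)
  also have "\<dots> = (tnorm ks X)\<^sup>2"
    unfolding power2_tnorm unfolding power2_eq_square by (simp add: act_act M act_mat_1[OF X])
  finally show ?thesis by simp
qed

text \<open>Componentwise convergence lets the limit rules for reals apply directly. Components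
  outside \<open>tindices\<close> are ignored, so limits are unique only within
  \<open>tspace\<close>.\<close>

definition tconv :: "nat list \<Rightarrow> (nat \<Rightarrow> ('n::finite) tdata) \<Rightarrow> 'n tdata \<Rightarrow> bool" where
  "tconv ks f Y \<longleftrightarrow> (\<forall>i l. (i, l) \<in> tindices ks \<longrightarrow> (\<lambda>j. f j i l) \<longlonglongrightarrow> Y i l)"

lemma tconvD: "tconv ks f Y \<Longrightarrow> (i, l) \<in> tindices ks \<Longrightarrow> (\<lambda>j. f j i l) \<longlonglongrightarrow> Y i l"
  by (simp add: tconv_def)

lemma tconv_iff_tnorm:
  fixes f :: "nat \<Rightarrow> ('n::finite) tdata"
  shows "tconv ks f Y \<longleftrightarrow> (\<lambda>j. tnorm ks (\<lambda>i l. f j i l - Y i l)) \<longlonglongrightarrow> 0"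
proof
  assume conv: "tconv ks f Y"
  have "(\<lambda>j. case c of (i, l) \<Rightarrow> (f j i l - Y i l)\<^sup>2) \<longlonglongrightarrow> (case c of (i, l) \<Rightarrow> (Y i l - Y i l)\<^sup>2)"
    if "c \<in> tindices ks" for c
    using that by (cases c) (simp only: prod.case, intro tendsto_intros tconvD[OF conv])
  then have "(\<lambda>j. \<Sum>(i, l)\<in>tindices ks. (f j i l - Y i l)\<^sup>2) \<longlonglongrightarrow> (\<Sum>(i, l)\<in>tindices ks. (Y i l - Y i l)\<^sup>2)"
    by (rule tendsto_sum)
  then have "(\<lambda>j. (tnorm ks (\<lambda>i l. f j i l - Y i l))\<^sup>2) \<longlonglongrightarrow> 0"
    by (simp add: power2_tnorm case_prod_unfold)
  then show "(\<lambda>j. tnorm ks (\<lambda>i l. f j i l - Y i l)) \<longlonglongrightarrow> 0"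
    using tendsto_real_sqrt by fastforce
next
  assume lim: "(\<lambda>j. tnorm ks (\<lambda>i l. f j i l - Y i l)) \<longlonglongrightarrow> 0"
  show "tconv ks f Y"
    unfolding tconv_def
  proof (intro allI impI)
    fix i and l :: "'n list"
    assume "(i, l) \<in> tindices ks"
    then have "(\<lambda>j. f j i l - Y i l) \<longlonglongrightarrow> 0"
      using component_le_tnorm[of i l ks "\<lambda>i l. f _ i l - Y i l"]
      by (intro tendsto_rabs_zero_cancel[OF tendsto_sandwich[OF _ _ tendsto_const lim]]) auto
    then show "(\<lambda>j. f j i l) \<longlonglongrightarrow> Y i l" by (simp add: LIM_zero_iff)
  qed
qed

lemma tconv_tnorm:
  assumes "tconv ks f Y"
  shows "(\<lambda>j. tnorm ks (f j)) \<longlonglongrightarrow> tnorm ks Y"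
  unfolding tnorm_def using tconvD[OF assms]
  by (intro tendsto_intros) (simp_all add: tindices_def)

lemma tconv_subseq:
  assumes "tconv ks f Y" "strict_mono r"
  shows "tconv ks (f \<circ> r) Y"
  unfolding tconv_def
  using LIMSEQ_subseq_LIMSEQ[OF tconvD[OF assms(1)] assms(2)] by (simp add: o_def)

lemma tconv_const: "tconv ks (\<lambda>j. Y) Y"
  by (auto simp: tconv_def)

lemma tconv_act:
  fixes f :: "nat \<Rightarrow> ('n::finite) tdata"
  assumes "tconv ks f Y" "M \<longlonglongrightarrow> N"
  shows "tconv ks (\<lambda>j. act ks (M j) (f j)) (act ks N Y)"
  unfolding tconv_def
proof (intro allI impI)
  fix i and l :: "'n list"
  assume il: "(i, l) \<in> tindices ks"
  then have "(i, m) \<in> tindices ks" if "m \<in> idx_lists (ks ! i)" for m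
    using that by (simp add: tindices_def)
  then have "(\<lambda>j. \<Sum>m\<in>idx_lists (ks ! i). (\<Prod>k<ks ! i. M j $ (m ! k) $ (l ! k)) * f j i m) \<longlonglongrightarrow>
      (\<Sum>m\<in>idx_lists (ks ! i). (\<Prod>k<ks ! i. N $ (m ! k) $ (l ! k)) * Y i m)"
    by (intro tendsto_intros tconvD[OF assms(1)] assms(2))
  then show "(\<lambda>j. act ks (M j) (f j) i l) \<longlonglongrightarrow> act ks N Y i l"
    using il by (simp add: act_def tindices_def)
qed

lemma tconv_unique:
  assumes "tconv ks f Y" "tconv ks f Z" "Y \<in> tspace ks" "Z \<in> tspace ks"
  shows "Y = Z"
  using assms(3,4) by (rule tspace_eqI) (blast intro: LIMSEQ_unique tconvD[OF assms(1)] tconvD[OF assms(2)])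

text \<open>Bolzano-Weierstrass one coordinate at a time: each induction step refines the
  subsequence found so far, which preserves the earlier limits.\<close>

lemma finite_family_convergent_subseq:
  fixes f :: "nat \<Rightarrow> 'a \<Rightarrow> real"
  assumes "finite I" "\<And>i. i \<in> I \<Longrightarrow> bounded (range (\<lambda>j. f j i))"
  shows "\<exists>r g. strict_mono r \<and> (\<forall>i\<in>I. (\<lambda>j. f (r j) i) \<longlonglongrightarrow> g i)"
  using assms
proof (induction I)
  case empty
  show ?case by (intro exI[of _ id]) (auto simp: strict_mono_def)
next
  case (insert i I)
  then obtain r g where r: "strict_mono (r :: nat \<Rightarrow> nat)" "\<And>i. i \<in> I \<Longrightarrow> (\<lambda>j. f (r j) i) \<longlonglongrightarrow> g i" by auto
  have "bounded (range (\<lambda>j. f (r j) i))"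
    using insert.prems[of i] by (rule bounded_subset) auto
  then obtain s l where s: "strict_mono (s :: nat \<Rightarrow> nat)" "(\<lambda>j. f (r (s j)) i) \<longlonglongrightarrow> l"
    using bounded_imp_convergent_subsequence[of "\<lambda>j. f (r j) i"] by (auto simp: o_def)
  have "(\<lambda>j. f ((r \<circ> s) j) x) \<longlonglongrightarrow> (g(i := l)) x" if "x \<in> insert i I" for x
    using that s LIMSEQ_subseq_LIMSEQ[OF r(2)[of x] s(1)] insert.hyps by (auto simp: o_def)
  then show ?case
    using strict_mono_o[OF r(1) s(1)] by blast
qed

lemma bounded_tdata_convergent_subseq:
  fixes f :: "nat \<Rightarrow> ('n::finite) tdata"
  assumes "\<And>j. tnorm ks (f j) \<le> C"
  obtains r Y where "strict_mono r" "Y \<in> tspace ks" "tconv ks (f \<circ> r) Y"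
proof -
  have bdd: "bounded (range (\<lambda>j. f j i l))" if "(i, l) \<in> tindices ks" for i and l :: "'n list"
    unfolding bounded_iff using component_le_tnorm[OF that] assms
    by (intro exI[of _ C]) (auto intro: order.trans)
  have "\<exists>r g. strict_mono r \<and> (\<forall>c\<in>tindices ks :: (nat \<times> 'n list) set. (\<lambda>j. (\<lambda>(i, l). f (r j) i l) c) \<longlonglongrightarrow> g c)"
    using finite_family_convergent_subseq[of "tindices ks :: (nat \<times> 'n list) set" "\<lambda>j (i, l). f j i l"] bdd by auto
  then obtain r g where r: "strict_mono r"
    "\<And>i l. (i, l) \<in> tindices ks \<Longrightarrow> (\<lambda>j. f (r j) i l) \<longlonglongrightarrow> g (i, l)" by force
  define Y where "Y = (\<lambda>i l. if (i, l) \<in> tindices ks then g (i, l) else 0)"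
  have "Y \<in> tspace ks" by (auto simp: Y_def tspace_def tindices_def)
  moreover have "tconv ks (f \<circ> r) Y" using r(2) by (auto simp: tconv_def Y_def)
  ultimately show ?thesis using that r(1) by blast
qed

lemma tconv_poly_fun:
  assumes "p \<in> poly_fun ks" "tconv ks f Y"
  shows "(\<lambda>j. p (f j)) \<longlonglongrightarrow> p Y"
  using assms(1)
proof induction
  case (coord i l)
  then show ?case by (intro tconvD[OF assms(2)]) (simp add: tindices_def)
qed (auto intro: tendsto_intros)

section \<open>Cartan decomposition of the pseudo-orthogonal group\<close>

text \<open>The matrix exponential of \<open>diag x\<close>; the matrices
  \<open>ediag (s *\<^sub>R x)\<close> form a one-parameter group.\<close>

definition ediag :: "real^'n \<Rightarrow> real^'n^'n" where
  "ediag x = diag (\<chi> a. exp (x $ a))"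

lemma ediag_mult_left: "(ediag x ** A) $ a $ b = exp (x $ a) * A $ a $ b"
  by (simp add: ediag_def diag_mult_left)

lemma ediag_mult_right: "(A ** ediag x) $ a $ b = A $ a $ b * exp (x $ b)"
  by (simp add: ediag_def diag_mult_right)

lemma transpose_ediag [simp]: "transpose (ediag x) = ediag x"
  by (simp add: ediag_def)

lemma ediag_0: "ediag 0 = mat 1"
  by (simp add: ediag_def diag_def mat_def vec_eq_iff)

lemma ediag_add: "ediag x ** ediag y = ediag (x + y)"
  unfolding vec_eq_iff ediag_mult_left by (simp add: ediag_def diag_def exp_add)

lemma tendsto_ediag [tendsto_intros]:
  assumes "(x \<longlongrightarrow> x0) F"
  shows "((\<lambda>j. ediag (x j)) \<longlongrightarrow> ediag x0) F"
proof (intro vec_tendstoI)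
  fix a b
  show "((\<lambda>j. ediag (x j) $ a $ b) \<longlongrightarrow> ediag x0 $ a $ b) F"
    by (cases "a = b") (auto simp: ediag_def diag_def intro!: tendsto_intros assms)
qed

lemma power2_norm_mult_ediag:
  fixes A :: "real^'n^'n"
  shows "(norm (A ** ediag x))\<^sup>2 = (\<Sum>b\<in>UNIV. exp (2 * x $ b) * (\<Sum>a\<in>UNIV. (A $ a $ b)\<^sup>2))"
  unfolding power2_norm_matrix ediag_mult_right
  by (subst sum.swap) (simp add: sum_distrib_left power_mult_distrib exp_double, simp add: mult.commute)

lemma transpose_eta [simp]: "transpose (eta S) = eta S"
  by (auto simp: eta_def transpose_def vec_eq_iff)

lemma eta_eta: "eta S ** eta S = mat 1"
proof -
  have eta_diag: "eta S = diag (\<chi> a. if a \<in> S then -1 else 1)" by (simp add: eta_def diag_def vec_eq_iff)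
  show ?thesis
    unfolding eta_diag vec_eq_iff diag_mult_left by (simp add: diag_def mat_def)
qed

lemma Ogroup_mult:
  assumes "M \<in> Ogroup S" "N \<in> Ogroup S"
  shows "M ** N \<in> Ogroup S"
proof -
  have "transpose (M ** N) ** eta S ** (M ** N) = transpose N ** (transpose M ** eta S ** M) ** N"
    by (simp add: matrix_transpose_mul matrix_mul_assoc)
  then show ?thesis using assms by (simp add: Ogroup_def)
qed

lemma mat_1_Ogroup: "mat 1 \<in> Ogroup S"
  by (simp add: Ogroup_def)

text \<open>Since \<open>eta S\<close> is an involution,
  \<open>eta S ** transpose M ** eta S\<close> is a left inverse of \<open>M\<close>, and a left
  inverse of a square matrix is also a right inverse. Hence the group is closed under
  transposition.\<close>

lemma Ogroup_mult_eta_transpose: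
  assumes "M \<in> Ogroup S"
  shows "M ** eta S ** transpose M = eta S"
proof -
  have "(eta S ** transpose M ** eta S) ** M = eta S ** (transpose M ** eta S ** M)"
    by (simp add: matrix_mul_assoc)
  then have "(eta S ** transpose M ** eta S) ** M = mat 1"
    using assms by (simp add: Ogroup_def eta_eta)
  then have inv: "M ** (eta S ** transpose M ** eta S) = mat 1"
    by (simp add: matrix_left_right_inverse)
  have "M ** eta S ** transpose M = M ** eta S ** transpose M ** (eta S ** eta S)"
    by (simp add: eta_eta)
  also have "\<dots> = M ** (eta S ** transpose M ** eta S) ** eta S"
    by (simp add: matrix_mul_assoc)
  finally show ?thesis by (simp add: inv)
qed

lemma Ogroup_limit:
  assumes "\<And>j. M j \<in> Ogroup S" "M \<longlonglongrightarrow> N"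
  shows "N \<in> Ogroup S"
proof -
  have "(\<lambda>j. transpose (M j) ** eta S ** M j) \<longlonglongrightarrow> transpose N ** eta S ** N"
    by (intro tendsto_intros assms)
  then show ?thesis using assms(1) by (simp add: Ogroup_def LIMSEQ_const_iff)
qed

text \<open>\<open>H\<close> is the form \<open>eta S\<close> in the basis of columns of
  \<open>U\<close>, and the hypothesis on \<open>x\<close> says that \<open>diag x\<close> is skew
  for \<open>H\<close>, the Lie algebra condition. Written as a vanishing product, it visibly
  survives scaling of \<open>x\<close> and limits.\<close>

lemma conj_ediag_Ogroup:
  assumes U: "orthogonal_matrix U"
    and x: "\<And>a b. (transpose U ** eta S ** U) $ a $ b * (x $ a + x $ b) = 0"
  shows "U ** ediag x ** transpose U \<in> Ogroup S"
proof -
  define H where "H = transpose U ** eta S ** U"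
  have "(ediag x ** H ** ediag x) $ a $ b = H $ a $ b" for a b
    using x[of a b]
    by (auto simp: ediag_mult_left ediag_mult_right H_def exp_add[symmetric] simp flip: mult.assoc)
  then have H: "ediag x ** H ** ediag x = H" by (simp add: vec_eq_iff)
  have "transpose (U ** ediag x ** transpose U) ** eta S ** (U ** ediag x ** transpose U) =
      U ** (ediag x ** H ** ediag x) ** transpose U"
    by (simp add: H_def matrix_transpose_mul matrix_mul_assoc)
  also have "\<dots> = (U ** transpose U) ** eta S ** (U ** transpose U)"
    unfolding H by (simp add: H_def matrix_mul_assoc)
  also have "\<dots> = eta S" using U by (simp add: orthogonal_matrix_def)
  finally show ?thesis by (simp add: Ogroup_def)
qed

text \<open>Polar decomposition. The matrix \<open>P = g ** transpose g\<close> is positive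
  definite, \<open>U ** ediag x ** transpose U\<close> is its square root, and \<open>k\<close> is
  the remaining orthogonal factor up to \<open>U\<close>. Because \<open>P\<close> preserves
  \<open>eta S\<close>, each nonzero entry of \<open>H\<close> forces
  \<open>exp (2 * (x $ a + x $ b)) = 1\<close>, so the exponents satisfy the Lie algebra
  condition.\<close>

lemma Ogroup_Cartan_decomposition:
  assumes g: "g \<in> Ogroup S"
  obtains U x k where "orthogonal_matrix U" "k ** transpose k = mat 1" "g = U ** ediag x ** k"
    "\<And>a b. (transpose U ** eta S ** U) $ a $ b * (x $ a + x $ b) = 0"
proof -
  define P where "P = g ** transpose g"
  have "transpose P = P" by (simp add: P_def matrix_transpose_mul)
  then obtain U d where U: "orthogonal_matrix U" and PU: "P ** U = U ** diag d"
    by (rule symmetric_matrix_diagonalisable)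
  have UU: "U ** transpose U = mat 1" "transpose U ** U = mat 1"
    using U by (auto simp: orthogonal_matrix_def)
  define H where "H = transpose U ** eta S ** U"
  have D: "transpose U ** P ** U = diag d"
    by (metis PU UU(2) matrix_mul_assoc matrix_mul_lid)
  have g_eta: "transpose g ** eta S ** g = eta S" using g by (simp add: Ogroup_def)
  \<comment> \<open>The eigenvalue \<open>d $ b\<close> is the squared length of row
    \<open>b\<close> of \<open>R\<close>, and no row of the invertible matrix \<open>R\<close>
    vanishes.\<close>
  have d_pos: "d $ b > 0" for b
  proof -
    define R where "R = transpose U ** g"
    have "R ** (eta S ** transpose g ** eta S ** U) = mat 1"
      unfolding R_def using Ogroup_mult_eta_transpose[OF g] eta_eta UU
      by (metis matrix_mul_assoc matrix_mul_rid)
    then have "(\<Sum>c\<in>UNIV. R $ b $ c * (eta S ** transpose g ** eta S ** U) $ c $ b) = 1"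
      by (simp add: matrix_matrix_mult_def mat_def vec_eq_iff)
    then obtain c where "R $ b $ c \<noteq> 0"
      by (metis (no_types, lifting) mult_zero_left sum.neutral zero_neq_one)
    moreover have "R ** transpose R = diag d"
      using D by (simp add: R_def P_def matrix_transpose_mul matrix_mul_assoc)
    then have "d $ b = (R ** transpose R) $ b $ b" by (simp add: diag_def)
    moreover have "(R ** transpose R) $ b $ b = (\<Sum>c\<in>UNIV. (R $ b $ c)\<^sup>2)"
      by (simp add: matrix_matrix_mult_def transpose_def power2_eq_square)
    ultimately show ?thesis
      by (simp add: sum_pos2[of UNIV c])
  qed
  define x where "x = (\<chi> b. ln (d $ b) / 2)"
  have dx: "diag d = ediag (x + x)"
    using d_pos by (simp add: ediag_def x_def diag_def vec_eq_iff)
  define k where "k = ediag (- x) ** transpose U ** g"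
  have "U ** ediag x ** k = U ** (ediag x ** ediag (- x)) ** transpose U ** g"
    by (simp add: k_def matrix_mul_assoc)
  then have "g = U ** ediag x ** k" by (simp add: ediag_add ediag_0 UU)
  moreover have "k ** transpose k = mat 1"
  proof -
    have "k ** transpose k = ediag (- x) ** (transpose U ** P ** U) ** ediag (- x)"
      by (simp add: k_def P_def matrix_transpose_mul matrix_mul_assoc)
    then show ?thesis by (simp add: D dx ediag_add ediag_0)
  qed
  moreover have "H $ a $ b * (x $ a + x $ b) = 0" for a b
  proof -
    have "P ** eta S ** P = g ** (transpose g ** eta S ** g) ** transpose g"
      by (simp add: P_def matrix_mul_assoc)
    then have P: "P ** eta S ** P = eta S" by (simp add: g_eta Ogroup_mult_eta_transpose[OF g])
    have "diag d ** H ** diag d = transpose U ** P ** (U ** transpose U) ** eta S ** (U ** transpose U) ** P ** U"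
      by (simp add: D[symmetric] H_def matrix_mul_assoc)
    also have "\<dots> = transpose U ** (P ** eta S ** P) ** U"
      by (simp add: UU matrix_mul_assoc)
    finally have "diag d ** H ** diag d = H" by (simp add: P H_def)
    then have "exp (x $ a + x $ a) * H $ a $ b * exp (x $ b + x $ b) = H $ a $ b"
      unfolding dx by (metis ediag_mult_left ediag_mult_right vector_add_component)
    then have "H $ a $ b * exp (2 * (x $ a + x $ b)) = H $ a $ b * 1"
      by (simp add: mult_ac distrib_left flip: exp_add)
    then show ?thesis by (subst (asm) mult_cancel_left) auto
  qed
  ultimately show ?thesis using that U by (simp add: H_def)
qed

section \<open>Minimal vectors have closed orbits\<close>

definition minimal_vector :: "nat list \<Rightarrow> 'n set \<Rightarrow> ('n::finite) tdata \<Rightarrow> bool" where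
  "minimal_vector ks S v \<longleftrightarrow> v \<in> tspace ks \<and> (\<forall>g\<in>Ogroup S. tnorm ks v \<le> tnorm ks (act ks g v))"

text \<open>The logarithm of the factor by which \<open>ediag x\<close> scales the component
  \<open>(i, l)\<close>, linear in \<open>x\<close>.\<close>

definition weight :: "nat list \<Rightarrow> real^'n \<Rightarrow> nat \<times> 'n list \<Rightarrow> real" where
  "weight ks x = (\<lambda>(i, l). \<Sum>j<ks ! i. x $ (l ! j))"

lemma act_ediag:
  assumes "X \<in> tspace ks"
  shows "act ks (ediag (s *\<^sub>R x)) X i l = exp (s * weight ks x (i, l)) * X i l"
  unfolding ediag_def act_diag[OF assms]
  by (simp add: weight_def exp_sum sum_distrib_left)

lemma power2_tnorm_act_ediag:
  assumes "X \<in> tspace ks"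
  shows "(tnorm ks (act ks (ediag (s *\<^sub>R x)) X))\<^sup>2 =
    (\<Sum>c\<in>tindices ks. exp (2 * s * weight ks x c) * (case c of (i, l) \<Rightarrow> (X i l)\<^sup>2))"
  unfolding power2_tnorm
proof (rule sum.cong[OF refl], clarify)
  fix i and l
  have "exp (2 * s * weight ks x (i, l)) = (exp (s * weight ks x (i, l)))\<^sup>2"
    by (simp add: mult.assoc flip: exp_double)
  then show "(act ks (ediag (s *\<^sub>R x)) X i l)\<^sup>2 = exp (2 * s * weight ks x (i, l)) * (X i l)\<^sup>2"
    by (simp add: act_ediag[OF assms] power_mult_distrib)
qed

text \<open>Boundedness for \<open>s \<ge> 0\<close> excludes positive exponents. With all remaining
  exponents nonpositive, a negative one would make the sum at \<open>s = 1\<close> smaller than at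
  \<open>s = 0\<close>.\<close>

lemma exp_sum_bounded_exponents_zero:
  fixes c w :: "'a \<Rightarrow> real"
  assumes I: "finite I" and c: "\<And>i. i \<in> I \<Longrightarrow> c i \<ge> 0"
    and bdd: "\<And>s. s \<ge> 0 \<Longrightarrow> (\<Sum>i\<in>I. exp (s * w i) * c i) \<le> D"
    and min: "\<And>s. (\<Sum>i\<in>I. c i) \<le> (\<Sum>i\<in>I. exp (s * w i) * c i)"
    and i: "i \<in> I" "c i \<noteq> 0"
  shows "w i = 0"
proof -
  have nonpos: "w i \<le> 0" if i: "i \<in> I" "c i \<noteq> 0" for i
  proof (rule ccontr)
    assume w: "\<not> w i \<le> 0"
    have ci: "c i > 0" using c i by force
    have single_le: "exp (s * w i) * c i \<le> D" if "s \<ge> 0" for s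
    proof -
      have "exp (s * w i) * c i \<le> (\<Sum>i\<in>I. exp (s * w i) * c i)"
        using I c i(1) by (intro member_le_sum) auto
      then show ?thesis using bdd[OF that] by simp
    qed
    have "D > 0" using single_le[of 0] ci by simp
    \<comment> \<open>Chosen so that the linear lower bound \<open>1 + s * w i\<close> for the
      exponential already pushes this single term above \<open>D\<close>.\<close>
    define s where "s = D / (c i * w i)"
    have s: "s * w i * c i = D" "s \<ge> 0" using ci w \<open>D > 0\<close> by (auto simp: s_def)
    have "(1 + s * w i) * c i \<le> exp (s * w i) * c i"
      using ci by (intro mult_right_mono) auto
    then have "c i + D \<le> D" using single_le[OF s(2)] s(1) by (simp add: distrib_right)
    then show False using ci by simp
  qed
  show ?thesis
  proof (rule ccontr)
    assume "w i \<noteq> 0"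
    then have "w i < 0" "c i > 0" using nonpos[OF i] c[OF i(1)] i(2) by auto
    then have "exp (w i) * c i < c i" by simp
    moreover have "exp (w k) * c k \<le> c k" if "k \<in> I" for k
      using nonpos[OF that] c[OF that] by (cases "c k = 0") (auto intro: mult_left_le_one_le)
    ultimately have "(\<Sum>i\<in>I. exp (w i) * c i) < (\<Sum>i\<in>I. c i)"
      using I i(1) by (intro sum_strict_mono_ex1) auto
    then show False using min[of 1] by simp
  qed
qed

lemma tnorm_act_conj_ediag:
  assumes U: "orthogonal_matrix U"
  shows "tnorm ks (act ks (U ** ediag x ** transpose U) X) = tnorm ks (act ks (ediag x) (act ks U X))"
proof -
  have "act ks (U ** ediag x ** transpose U) X = act ks (transpose U) (act ks (ediag x) (act ks U X))"
    by (simp add: act_act matrix_mul_assoc)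
  then show ?thesis
    using U by (simp add: tnorm_act_orthogonal[OF act_in_tspace] orthogonal_matrix_def)
qed

text \<open>The squared norm along the limiting direction is a bounded exponential sum with its minimum
  at 0, so all exponents that occur vanish.\<close>
lemma bounded_direction_stabilises:
  assumes v: "minimal_vector ks S v"
    and U: "\<And>j. orthogonal_matrix (U j)" "U \<longlonglongrightarrow> U0" "orthogonal_matrix U0"
    and x: "x \<longlonglongrightarrow> x0"
    and x0: "\<And>a b. (transpose U0 ** eta S ** U0) $ a $ b * (x0 $ a + x0 $ b) = 0"
    and t: "filterlim t at_top sequentially"
    and C: "\<And>j. tnorm ks (act ks (ediag (t j *\<^sub>R x j)) (act ks (U j) v)) \<le> C"
  shows "act ks (U0 ** ediag (s *\<^sub>R x0) ** transpose U0) v = v"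
proof -
  have vt: "v \<in> tspace ks" and min: "\<And>g. g \<in> Ogroup S \<Longrightarrow> tnorm ks v \<le> tnorm ks (act ks g v)"
    using v by (auto simp: minimal_vector_def)
  define u where "u j = act ks (U j) v" for j
  define u0 where "u0 = act ks U0 v"
  have ut: "u j \<in> tspace ks" "u0 \<in> tspace ks" for j by (simp_all add: u_def u0_def act_in_tspace)
  have tnorm_u: "tnorm ks (u j) = tnorm ks v" "tnorm ks u0 = tnorm ks v" for j
    using U vt by (auto simp: u_def u0_def orthogonal_matrix_def intro!: tnorm_act_orthogonal)
  define q where "q i l = (u0 i l)\<^sup>2" for i l
  \<comment> \<open>For fixed \<open>s\<close> the bound holds along the sequence as soon as
    \<open>t j \<ge> s\<close>, and then passes to the limit.\<close>
  have bdd: "(tnorm ks (act ks (ediag (s *\<^sub>R x0)) u0))\<^sup>2 \<le> (tnorm ks v)\<^sup>2 + C\<^sup>2" if "s \<ge> 0" for s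
  proof (rule LIMSEQ_le_const2)
    have "tconv ks (\<lambda>j. act ks (ediag (s *\<^sub>R x j)) (u j)) (act ks (ediag (s *\<^sub>R x0)) u0)"
      unfolding u_def u0_def by (intro tconv_act tconv_const tendsto_intros U x)
    then show "(\<lambda>j. (tnorm ks (act ks (ediag (s *\<^sub>R x j)) (u j)))\<^sup>2)
        \<longlonglongrightarrow> (tnorm ks (act ks (ediag (s *\<^sub>R x0)) u0))\<^sup>2"
      by (intro tendsto_intros tconv_tnorm)
    have "\<forall>\<^sub>F j in sequentially. t j \<ge> s" using t by (simp add: filterlim_at_top)
    then have "\<forall>\<^sub>F j in sequentially. (tnorm ks (act ks (ediag (s *\<^sub>R x j)) (u j)))\<^sup>2 \<le> (tnorm ks v)\<^sup>2 + C\<^sup>2"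
    proof eventually_elim
      case (elim j)
      let ?w = "weight ks (x j)" and ?c = "\<lambda>c. case c of (i, l) \<Rightarrow> (u j i l)\<^sup>2"
      \<comment> \<open>On the interval from 0 to \<open>t j\<close> the exponential is largest at
        an endpoint. Adding both endpoint values covers either sign of the weight; summed up, they
        are the squared norms at times 0 and \<open>t j\<close>.\<close>
      have le: "exp (2 * s * ?w c) \<le> 1 + exp (2 * t j * ?w c)" for c
      proof (cases "?w c \<ge> 0")
        case True
        then have "exp (2 * s * ?w c) \<le> exp (2 * t j * ?w c)"
          using elim by (simp add: mult_right_mono)
        then show ?thesis by linarith
      next
        case False
        then have "2 * s * ?w c \<le> 0" using that by (simp add: mult_nonneg_nonpos)
        then show ?thesis using exp_gt_zero[of "2 * t j * ?w c"] by (smt (verit) exp_le_one_iff)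
      qed
      have "(tnorm ks (act ks (ediag (s *\<^sub>R x j)) (u j)))\<^sup>2 \<le>
          (\<Sum>c\<in>tindices ks. (1 + exp (2 * t j * ?w c)) * ?c c)"
        unfolding power2_tnorm_act_ediag[OF ut(1)]
        by (intro sum_mono mult_right_mono le) auto
      also have "\<dots> = (tnorm ks (u j))\<^sup>2 + (tnorm ks (act ks (ediag (t j *\<^sub>R x j)) (u j)))\<^sup>2"
        unfolding power2_tnorm_act_ediag[OF ut(1)] power2_tnorm[of ks "u j"]
        by (simp add: distrib_right sum.distrib)
      also have "\<dots> \<le> (tnorm ks v)\<^sup>2 + C\<^sup>2"
        using C[of j] by (auto simp: u_def[symmetric] tnorm_u intro!: power_mono)
      finally show ?case .
    qed
    then show "\<exists>N. \<forall>j\<ge>N. (tnorm ks (act ks (ediag (s *\<^sub>R x j)) (u j)))\<^sup>2 \<le> (tnorm ks v)\<^sup>2 + C\<^sup>2"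
      by (simp add: eventually_sequentially)
  qed
  \<comment> \<open>Conjugation by \<open>U0\<close> carries the diagonal one-parameter group into
    the pseudo-orthogonal group, where minimality of \<open>v\<close> applies for every real
    \<open>s\<close>.\<close>
  have ge: "(tnorm ks v)\<^sup>2 \<le> (tnorm ks (act ks (ediag (s *\<^sub>R x0)) u0))\<^sup>2" for s
  proof -
    have "U0 ** ediag (s *\<^sub>R x0) ** transpose U0 \<in> Ogroup S"
      using x0 by (intro conj_ediag_Ogroup[OF U(3)]) (simp flip: distrib_left add: mult.left_commute)
    from min[OF this] show ?thesis
      by (intro power_mono) (simp_all add: tnorm_act_conj_ediag[OF U(3)] u0_def)
  qed
  have w0: "weight ks x0 (i, l) = 0" if "(i, l) \<in> tindices ks" "u0 i l \<noteq> 0" for i l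
  proof -
    let ?c = "\<lambda>c. case c of (i, l) \<Rightarrow> (u0 i l)\<^sup>2"
    have eq: "(\<Sum>c\<in>tindices ks. exp (s * (2 * weight ks x0 c)) * ?c c) =
        (tnorm ks (act ks (ediag (s *\<^sub>R x0)) u0))\<^sup>2" for s
      unfolding power2_tnorm_act_ediag[OF ut(2)] by (simp add: mult_ac)
    have "2 * weight ks x0 (i, l) = 0"
    proof (rule exp_sum_bounded_exponents_zero[of "tindices ks" ?c])
      show "(\<Sum>c\<in>tindices ks. exp (s * (2 * weight ks x0 c)) * ?c c) \<le> (tnorm ks v)\<^sup>2 + C\<^sup>2"
        if "s \<ge> 0" for s
        unfolding eq by (rule bdd[OF that])
      show "(\<Sum>c\<in>tindices ks. ?c c) \<le> (\<Sum>c\<in>tindices ks. exp (s * (2 * weight ks x0 c)) * ?c c)" for s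
        unfolding eq power2_tnorm[symmetric] tnorm_u by (rule ge)
    qed (use that in auto)
    then show ?thesis by simp
  qed
  have "act ks (ediag (s *\<^sub>R x0)) u0 = u0"
    by (rule tspace_eqI[OF act_in_tspace ut(2)]) (use w0 in \<open>force simp: act_ediag[OF ut(2)]\<close>)
  then have "act ks (transpose U0) (act ks (ediag (s *\<^sub>R x0)) (act ks U0 v)) = act ks (transpose U0) (act ks U0 v)"
    unfolding u0_def by simp
  then show ?thesis
    using U(3) vt by (simp add: act_act matrix_mul_assoc act_mat_1 orthogonal_matrix_def)
qed

text \<open>Once \<open>U j\<close> is close to \<open>U0\<close>, the squared norms are dominated by the columns \<open>b\<close> with
  \<open>x0 $ b > 0\<close>, and these shrink by about the factor \<open>exp (- 2 * x0 $ b)\<close>.\<close>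
lemma eventually_norm_shrinks:
  fixes U :: "nat \<Rightarrow> real^'n^'n"
  assumes U: "\<And>j. orthogonal_matrix (U j)" "U \<longlonglongrightarrow> U0" "orthogonal_matrix U0"
    and x: "x \<longlonglongrightarrow> x0" and b: "x0 $ b > 0"
    and t: "filterlim t at_top sequentially"
  shows "\<exists>j. norm (U0 ** ediag (- x0) ** transpose U0 ** U j ** ediag (t j *\<^sub>R x j)) < norm (ediag (t j *\<^sub>R x j))"
proof (rule ccontr)
  assume "\<not> ?thesis"
  then have le: "norm (ediag (t j *\<^sub>R x j)) \<le> norm (U0 ** ediag (- x0) ** transpose U0 ** U j ** ediag (t j *\<^sub>R x j))" for j
    by (force simp: not_less)
  have UU: "U0 ** transpose U0 = mat 1" "transpose U0 ** U0 = mat 1"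
    "U j ** transpose (U j) = mat 1" "transpose (U j) ** U j = mat 1" for j
    using U by (auto simp: orthogonal_matrix_def)
  define O' where "O' j = transpose U0 ** U j" for j
  have O'_lim: "O' \<longlonglongrightarrow> mat 1"
    unfolding O'_def UU(2)[symmetric] by (intro tendsto_intros U)
  \<comment> \<open>The change in squared length of column \<open>a\<close> of \<open>O' j\<close>
    under left multiplication by \<open>ediag (- x0)\<close>. If the norm never shrinks, the sum of
    these changes with weights \<open>exp (2 * t j * x j $ a)\<close> is nonnegative.\<close>
  define c where "c j a = (\<Sum>i\<in>UNIV. (exp (- 2 * x0 $ i) - 1) * (O' j $ i $ a)\<^sup>2)" for j a
  define c0 where "c0 a = exp (- 2 * x0 $ a) - 1" for a
  have c_lim: "(\<lambda>j. c j a) \<longlonglongrightarrow> c0 a" for a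
  proof -
    have "(\<lambda>j. c j a) \<longlonglongrightarrow> (\<Sum>i\<in>UNIV. (exp (- 2 * x0 $ i) - 1) * ((mat 1 :: real^'n^'n) $ i $ a)\<^sup>2)"
      unfolding c_def by (intro tendsto_intros O'_lim)
    moreover have "((mat 1 :: real^'n^'n) $ i $ a)\<^sup>2 = (if i = a then 1 else 0)" for i
      by (simp add: mat_def)
    ultimately show ?thesis by (simp add: c0_def if_distrib cong: if_cong)
  qed
  have sum_nonneg: "0 \<le> (\<Sum>a\<in>UNIV. exp (2 * t j * x j $ a) * c j a)" for j
  proof -
    let ?E = "ediag (t j *\<^sub>R x j)"
    have "norm ?E = norm (O' j ** ?E)"
      unfolding O'_def
      by (simp add: matrix_mul_assoc[symmetric] norm_orthogonal_matrix_mult UU)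
    moreover have "norm (U0 ** ediag (- x0) ** transpose U0 ** U j ** ?E) = norm ((ediag (- x0) ** O' j) ** ?E)"
      unfolding O'_def
      by (simp add: matrix_mul_assoc[symmetric] norm_orthogonal_matrix_mult UU)
    ultimately have "(norm (O' j ** ?E))\<^sup>2 \<le> (norm ((ediag (- x0) ** O' j) ** ?E))\<^sup>2"
      using le[of j] by (intro power_mono) auto
    then show ?thesis
      unfolding power2_norm_mult_ediag ediag_mult_left
      by (simp add: c_def algebra_simps sum_subtractf power_mult_distrib flip: exp_double)
  qed
  define \<delta> where "\<delta> = x0 $ b"
  have \<delta>: "\<delta> > 0" using b by (simp add: \<delta>_def)
  \<comment> \<open>Eventual upper bounds for the summands after division by
    \<open>exp (t j * \<delta>)\<close>. Column \<open>b\<close> keeps a factor at least 1 and a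
    negative coefficient; other columns with \<open>x0 $ a > 0\<close> contribute negative terms;
    the rest decay like \<open>exp (- (t j * \<delta> / 2))\<close>. The total tends to
    \<open>c0 b / 2 < 0\<close>.\<close>
  define B where "B j a = (if a = b then c0 b / 2 else \<bar>c j a\<bar> * exp (- (t j * \<delta> / 2)))" for j a
  have c0b: "c0 b < 0" using b by (simp add: c0_def)
  have t_pos: "\<forall>\<^sub>F j in sequentially. t j \<ge> 0" using t by (simp add: filterlim_at_top)
  have xa: "(\<lambda>j. x j $ a) \<longlonglongrightarrow> x0 $ a" for a by (intro tendsto_intros x)
  have "\<forall>\<^sub>F j in sequentially. exp (2 * t j * (x j $ a - \<delta> / 2)) * c j a \<le> B j a" for a
  proof (cases "a = b")
    case True
    have "\<forall>\<^sub>F j in sequentially. c j b < c0 b / 2" using c0b by (intro order_tendstoD[OF c_lim]) simp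
    moreover have "\<forall>\<^sub>F j in sequentially. x j $ b > \<delta> / 2"
      using \<delta> by (intro order_tendstoD[OF xa]) (simp add: \<delta>_def)
    ultimately show ?thesis using t_pos
    proof eventually_elim
      case (elim j)
      then have "1 \<le> exp (2 * t j * (x j $ b - \<delta> / 2))" by simp
      then have "exp (2 * t j * (x j $ b - \<delta> / 2)) * c j b \<le> 1 * c j b"
        using elim c0b by (intro mult_right_mono_neg) auto
      then show ?case using elim True by (simp add: B_def)
    qed
  next
    case False
    show ?thesis
    proof (cases "x0 $ a > 0")
      case True
      then have "c0 a < 0" by (simp add: c0_def)
      then have "\<forall>\<^sub>F j in sequentially. c j a < 0" by (intro order_tendstoD[OF c_lim])
      then show ?thesis
      proof eventually_elim
        case (elim j)
        then have "exp (2 * t j * (x j $ a - \<delta> / 2)) * c j a \<le> 0" by (simp add: mult_nonneg_nonpos)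
        then show ?case using False by (simp add: B_def) (smt (verit) abs_ge_zero exp_gt_zero mult_nonneg_nonneg)
      qed
    next
      case a: False
      have "\<forall>\<^sub>F j in sequentially. x j $ a < \<delta> / 4"
        using \<delta> a by (intro order_tendstoD[OF xa]) simp
      then show ?thesis using t_pos
      proof eventually_elim
        case (elim j)
        have "t j * (2 * (x j $ a - \<delta> / 2)) \<le> t j * (- (\<delta> / 2))"
          using elim by (intro mult_left_mono) auto
        then have "exp (2 * t j * (x j $ a - \<delta> / 2)) \<le> exp (- (t j * \<delta> / 2))" by (simp add: mult_ac)
        then have "exp (2 * t j * (x j $ a - \<delta> / 2)) * c j a \<le> exp (- (t j * \<delta> / 2)) * \<bar>c j a\<bar>"
          by (smt (verit) abs_ge_self exp_gt_zero mult_left_mono mult_right_mono)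
        then show ?case using False by (simp add: B_def mult.commute)
      qed
    qed
  qed
  then have "\<forall>\<^sub>F j in sequentially. \<forall>a\<in>UNIV. exp (2 * t j * (x j $ a - \<delta> / 2)) * c j a \<le> B j a"
    by (intro eventually_ball_finite) auto
  then have ev: "\<forall>\<^sub>F j in sequentially. 0 \<le> (\<Sum>a\<in>UNIV. B j a)"
  proof eventually_elim
    case (elim j)
    have "exp (2 * t j * (x j $ a - \<delta> / 2)) = exp (- (t j * \<delta>)) * exp (2 * t j * x j $ a)" for a
      by (simp add: algebra_simps flip: exp_add)
    then have "(\<Sum>a\<in>UNIV. exp (2 * t j * (x j $ a - \<delta> / 2)) * c j a) =
        exp (- (t j * \<delta>)) * (\<Sum>a\<in>UNIV. exp (2 * t j * x j $ a) * c j a)"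
      by (simp add: sum_distrib_left mult.assoc)
    then have "0 \<le> (\<Sum>a\<in>UNIV. exp (2 * t j * (x j $ a - \<delta> / 2)) * c j a)"
      using sum_nonneg[of j] by simp
    also have "\<dots> \<le> (\<Sum>a\<in>UNIV. B j a)" using elim by (intro sum_mono) auto
    finally show ?case .
  qed
  have "filterlim (\<lambda>j. - (t j * \<delta> / 2)) at_bot sequentially"
    using filterlim_at_top_mult_tendsto_pos[OF tendsto_const _ t, of "\<delta> / 2"] \<delta>
    by (simp add: filterlim_uminus_at_bot)
  then have "(\<lambda>j. exp (- (t j * \<delta> / 2))) \<longlonglongrightarrow> 0"
    by (rule filterlim_compose[OF exp_at_bot])
  then have "(\<lambda>j. \<bar>c j a\<bar> * exp (- (t j * \<delta> / 2))) \<longlonglongrightarrow> \<bar>c0 a\<bar> * 0" for a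
    by (intro tendsto_intros c_lim)
  then have "(\<lambda>j. B j a) \<longlonglongrightarrow> (if a = b then c0 b / 2 else 0)" for a
    by (auto simp: B_def)
  then have "(\<lambda>j. \<Sum>a\<in>UNIV. B j a) \<longlonglongrightarrow> (\<Sum>a\<in>UNIV. if a = b then c0 b / 2 else 0)"
    by (intro tendsto_sum) auto
  then have "0 \<le> (\<Sum>a\<in>UNIV. if a = b then c0 b / 2 else 0)"
    by (rule tendsto_lowerbound[OF _ ev]) simp
  then show False using c0b by simp
qed

text \<open>A crude bound, sufficient to conclude that the exponent vectors are unbounded when the
  group elements are.\<close>

lemma norm_ediag_le: "norm (ediag x :: real^'n^'n) \<le> real CARD('n) * exp (norm x)"
proof -
  have "(norm (ediag x))\<^sup>2 = (\<Sum>b\<in>UNIV. exp (2 * x $ b) * (\<Sum>a\<in>UNIV. ((mat 1 :: real^'n^'n) $ a $ b)\<^sup>2))"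
    using power2_norm_mult_ediag[of "mat 1" x] by simp
  also have "\<dots> = (\<Sum>b\<in>UNIV. exp (2 * x $ b))"
    by (simp add: mat_def if_distrib[of "\<lambda>x. x\<^sup>2"] cong: if_cong)
  also have "\<dots> \<le> (\<Sum>b\<in>(UNIV :: 'n set). (exp (norm x))\<^sup>2)"
    using component_le_norm_cart[of x] by (intro sum_mono) (auto simp flip: exp_double intro: order.trans[OF abs_ge_self])
  also have "\<dots> \<le> (real CARD('n) * exp (norm x))\<^sup>2"
    by (simp add: power_mult_distrib) (simp add: power2_eq_square)
  finally show ?thesis by (simp add: power2_le_iff_abs_le)
qed

text \<open>The restriction to shortest elements matters: the stabiliser of \<open>v\<close> may be
  noncompact, and then group elements with one and the same value on \<open>v\<close> can be
  arbitrarily large.\<close>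

lemma minimal_vector_shortest_elements_bounded:
  fixes v :: "('n::finite) tdata"
  assumes v: "minimal_vector ks S v"
  shows "\<exists>B. \<forall>g\<in>Ogroup S. tnorm ks (act ks g v) \<le> C \<longrightarrow>
    (\<forall>h\<in>Ogroup S. act ks h v = act ks g v \<longrightarrow> norm g \<le> norm h) \<longrightarrow> norm g \<le> B"
proof (rule ccontr)
  assume neg: "\<not> ?thesis"
  \<comment> \<open>The orthogonal factor \<open>k\<close> of the Cartan decomposition changes
    neither the Frobenius norm nor \<open>tnorm\<close> and is dropped. Minimal length is restated
    through the stabiliser: as \<open>act\<close> is a right action, \<open>h ** g\<close> has the
    same value on \<open>v\<close> as \<open>g\<close> when \<open>h\<close> fixes
    \<open>v\<close>.\<close>
  have "\<exists>U y. orthogonal_matrix U \<and>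
      (\<forall>a b. (transpose U ** eta S ** U) $ a $ b * (y $ a + y $ b) = 0) \<and>
      real j < norm (ediag y) \<and> tnorm ks (act ks (ediag y) (act ks U v)) \<le> C \<and>
      (\<forall>h\<in>Ogroup S. act ks h v = v \<longrightarrow> norm (ediag y) \<le> norm (h ** U ** ediag y))" for j
  proof -
    obtain g where g: "g \<in> Ogroup S" "tnorm ks (act ks g v) \<le> C" "norm g > real j"
      and short: "\<And>h. h \<in> Ogroup S \<Longrightarrow> act ks h v = act ks g v \<Longrightarrow> norm g \<le> norm h"
      using neg by (meson not_le)
    obtain U y k where U: "orthogonal_matrix U" and k: "k ** transpose k = mat 1"
      and gU: "g = U ** ediag y ** k"
      and sym: "\<And>a b. (transpose U ** eta S ** U) $ a $ b * (y $ a + y $ b) = 0"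
      using Ogroup_Cartan_decomposition[OF g(1)] by metis
    have ng: "norm g = norm (ediag y)"
      using U k by (simp add: gU norm_mult_orthogonal_matrix norm_orthogonal_matrix_mult orthogonal_matrix_def)
    have "act ks g v = act ks k (act ks (ediag y) (act ks U v))"
      by (simp add: gU act_act)
    then have "tnorm ks (act ks (ediag y) (act ks U v)) \<le> C"
      using g(2) by (simp add: tnorm_act_orthogonal[OF act_in_tspace k])
    moreover have "norm (ediag y) \<le> norm (h ** U ** ediag y)" if h: "h \<in> Ogroup S" "act ks h v = v" for h
    proof -
      have "act ks (h ** g) v = act ks g v" by (simp add: h(2) flip: act_act)
      then have "norm g \<le> norm (h ** g)" using short Ogroup_mult[OF h(1) g(1)] by blast
      then show ?thesis
        unfolding ng by (simp add: gU matrix_mul_assoc norm_mult_orthogonal_matrix[OF k])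
    qed
    ultimately show ?thesis using U sym g(3) ng by metis
  qed
  then obtain U y where U: "\<And>j. orthogonal_matrix (U j)"
    and sym: "\<And>j a b. (transpose (U j) ** eta S ** U j) $ a $ b * (y j $ a + y j $ b) = 0"
    and large: "\<And>j. real j < norm (ediag (y j))"
    and C: "\<And>j. tnorm ks (act ks (ediag (y j)) (act ks (U j) v)) \<le> C"
    and short: "\<And>j h. h \<in> Ogroup S \<Longrightarrow> act ks h v = v \<Longrightarrow> norm (ediag (y j)) \<le> norm (h ** U j ** ediag (y j))"
    by metis
  define t where "t j = norm (y j)" for j
  \<comment> \<open>Unit direction of \<open>y j\<close>. If \<open>y j = 0\<close>, division by
    zero gives \<open>x j = 0\<close>, which keeps the equation
    \<open>y j = t j *\<^sub>R x j\<close> true.\<close>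
  define x where "x j = y j /\<^sub>R t j" for j
  have y: "y j = t j *\<^sub>R x j" for j by (cases "y j = 0") (simp_all add: x_def t_def)
  have t: "filterlim t at_top sequentially"
    unfolding filterlim_at_top
  proof
    fix Z :: real
    obtain N where N: "real CARD('n) * exp Z < real N" using reals_Archimedean2 by blast
    have "Z \<le> t j" if "j \<ge> N" for j
    proof (rule ccontr)
      assume "\<not> Z \<le> t j"
      then have "real CARD('n) * exp (norm (y j)) \<le> real CARD('n) * exp Z" by (simp add: t_def)
      then show False using large[of j] norm_ediag_le[of "y j"] N that by linarith
    qed
    then show "\<forall>\<^sub>F j in sequentially. Z \<le> t j" by (auto simp: eventually_sequentially)
  qed
  have norm_U: "norm (U j) = norm (mat 1 :: real^'n^'n)" for j
    using norm_orthogonal_matrix_mult[of "U j" "mat 1"] U by (simp add: orthogonal_matrix_def)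
  have norm_x: "norm (x j) \<le> 1" for j by (cases "y j = 0") (simp_all add: x_def t_def)
  have "range (\<lambda>j. (U j, x j)) \<subseteq> cball 0 (norm (mat 1 :: real^'n^'n)) \<times> cball 0 1"
    using norm_U norm_x by auto
  then have "bounded (range (\<lambda>j. (U j, x j)))"
    by (rule bounded_subset[rotated]) (intro bounded_Times bounded_cball)
  then obtain l r where r: "strict_mono (r :: nat \<Rightarrow> nat)" and l: "((\<lambda>j. (U j, x j)) \<circ> r) \<longlonglongrightarrow> l"
    using bounded_imp_convergent_subsequence by blast
  define U0 where "U0 = fst l"
  define x0 where "x0 = snd l"
  have U0: "(\<lambda>j. U (r j)) \<longlonglongrightarrow> U0" and x0: "(\<lambda>j. x (r j)) \<longlonglongrightarrow> x0"
    using tendsto_fst[OF l] tendsto_snd[OF l] by (simp_all add: o_def U0_def x0_def)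
  have tr: "filterlim (\<lambda>j. t (r j)) at_top sequentially"
    by (rule filterlim_compose[OF t filterlim_subseq[OF r]])
  have "(\<lambda>j. transpose (U (r j)) ** U (r j)) \<longlonglongrightarrow> transpose U0 ** U0" by (intro tendsto_intros U0)
  then have orth0: "orthogonal_matrix U0"
    using U by (simp add: orthogonal_matrix LIMSEQ_const_iff)
  have sym0: "(transpose U0 ** eta S ** U0) $ a $ b * (x0 $ a + x0 $ b) = 0" for a b
  proof -
    have "(\<lambda>j. (transpose (U (r j)) ** eta S ** U (r j)) $ a $ b * (x (r j) $ a + x (r j) $ b))
        \<longlonglongrightarrow> (transpose U0 ** eta S ** U0) $ a $ b * (x0 $ a + x0 $ b)"
      by (intro tendsto_intros U0 x0)
    moreover have "(transpose (U j) ** eta S ** U j) $ a $ b * (x j $ a + x j $ b) = 0" for j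
      using sym[of j a b] by (auto simp: x_def simp flip: distrib_left)
    ultimately show ?thesis by (simp add: LIMSEQ_const_iff)
  qed
  have "\<forall>\<^sub>F j in sequentially. t (r j) \<ge> 1" using tr by (simp add: filterlim_at_top)
  then have "\<forall>\<^sub>F j in sequentially. norm (x (r j)) = 1"
  proof eventually_elim
    case (elim j)
    then have "y (r j) \<noteq> 0" by (auto simp: t_def)
    then show ?case by (simp add: x_def t_def)
  qed
  then have "norm x0 = 1"
    by (intro LIMSEQ_unique[OF tendsto_norm[OF x0]] tendsto_eventually)
  then have "x0 \<noteq> 0" by auto
  then obtain a where a: "x0 $ a \<noteq> 0" by (auto simp: vec_eq_iff)
  \<comment> \<open>If \<open>x0 $ a\<close> is negative, invertibility of \<open>H\<close> gives a
    nonzero entry \<open>H $ a $ c\<close>, and the Lie algebra condition then forces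
    \<open>x0 $ c = - x0 $ a > 0\<close>.\<close>
  obtain b where b: "x0 $ b > 0"
  proof (cases "x0 $ a > 0")
    case False
    define H where "H = transpose U0 ** eta S ** U0"
    have "H ** H = transpose U0 ** eta S ** (U0 ** transpose U0) ** eta S ** U0"
      by (simp add: H_def matrix_mul_assoc)
    also have "\<dots> = transpose U0 ** (eta S ** eta S) ** U0"
      using orth0 by (simp add: orthogonal_matrix_def matrix_mul_assoc)
    finally have "H ** H = mat 1" using orth0 by (simp add: eta_eta orthogonal_matrix_def)
    then have "(\<Sum>c\<in>UNIV. H $ a $ c * H $ c $ a) = 1"
      by (simp add: matrix_matrix_mult_def mat_def vec_eq_iff)
    then obtain c where "H $ a $ c \<noteq> 0"
      by (metis (no_types, lifting) mult_zero_left sum.neutral zero_neq_one)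
    then have "x0 $ a + x0 $ c = 0" using sym0[of a c] by (simp add: H_def)
    then show ?thesis using that[of c] False a by simp
  qed (use that in blast)
  \<comment> \<open>The parameter value -1 is the backward step along the limiting direction, the
    one that shortens the group elements.\<close>
  have stab: "act ks (U0 ** ediag (- 1 *\<^sub>R x0) ** transpose U0) v = v"
    using C[unfolded y] U by (intro bounded_direction_stabilises[OF v _ U0 orth0 x0 sym0 tr]) auto
  have grp: "U0 ** ediag (- 1 *\<^sub>R x0) ** transpose U0 \<in> Ogroup S"
  proof (rule conj_ediag_Ogroup[OF orth0])
    show "(transpose U0 ** eta S ** U0) $ a $ b * ((- 1 *\<^sub>R x0) $ a + (- 1 *\<^sub>R x0) $ b) = 0" for a b
      using sym0[of a b] by auto
  qed
  obtain j where "norm (U0 ** ediag (- x0) ** transpose U0 ** U (r j) ** ediag (t (r j) *\<^sub>R x (r j)))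
      < norm (ediag (t (r j) *\<^sub>R x (r j)))"
    using eventually_norm_shrinks[OF _ U0 orth0 x0 b tr] U by blast
  then show False using short[OF grp stab, of "r j"] by (simp add: y)
qed

text \<open>The group elements with a prescribed value on \<open>v\<close> form a nonempty closed
  set of matrices, so the distance from 0 to it is attained.\<close>

lemma shortest_group_element:
  assumes "g \<in> Ogroup S"
  obtains h where "h \<in> Ogroup S" "act ks h v = act ks g v"
    "\<And>h'. h' \<in> Ogroup S \<Longrightarrow> act ks h' v = act ks h v \<Longrightarrow> norm h \<le> norm h'"
proof -
  define A where "A = {h \<in> Ogroup S. act ks h v = act ks g v}"
  have "closed A"
    unfolding closed_sequential_limits
  proof (intro allI impI)
    fix h l assume h: "(\<forall>j. h j \<in> A) \<and> h \<longlonglongrightarrow> l"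
    then have "l \<in> Ogroup S" using Ogroup_limit[of h S l] by (auto simp: A_def)
    moreover have "tconv ks (\<lambda>j. act ks (h j) v) (act ks l v)"
      using h by (intro tconv_act tconv_const) auto
    then have "tconv ks (\<lambda>j. act ks g v) (act ks l v)" using h by (simp add: A_def)
    then have "act ks l v = act ks g v"
      using tconv_const act_in_tspace tconv_unique by metis
    ultimately show "l \<in> A" by (simp add: A_def)
  qed
  moreover have "A \<noteq> {}" using assms by (auto simp: A_def)
  ultimately obtain h where "h \<in> A" "\<And>h'. h' \<in> A \<Longrightarrow> dist 0 h \<le> dist 0 h'"
    using distance_attains_inf[of A 0] by blast
  then show ?thesis using that[of h] by (auto simp: A_def)
qed

theorem minimal_vector_closed_orbit:
  assumes v: "minimal_vector ks S v"
  shows "char_by_invariants ks S v"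
  unfolding char_by_invariants_def closed_in_tspace_def
proof (intro allI impI, elim conjE)
  fix f Y
  assume f: "\<forall>j. f j \<in> orbit ks S v" and Y: "Y \<in> tspace ks"
    and "(\<lambda>j. tnorm ks (\<lambda>i l. f j i l - Y i l)) \<longlonglongrightarrow> 0"
  then have fY: "tconv ks f Y" by (simp add: tconv_iff_tnorm)
  \<comment> \<open>A convergent sequence is bounded in norm, which supplies the constant for the
    bound on shortest representatives.\<close>
  obtain C where C: "\<And>j. tnorm ks (f j) \<le> C"
    using convergent_imp_Bseq[OF convergentI[OF tconv_tnorm[OF fY]]] by (auto simp: Bseq_def)
  obtain B where B: "\<And>g. g \<in> Ogroup S \<Longrightarrow> tnorm ks (act ks g v) \<le> C \<Longrightarrow>
      (\<And>h. h \<in> Ogroup S \<Longrightarrow> act ks h v = act ks g v \<Longrightarrow> norm g \<le> norm h) \<Longrightarrow> norm g \<le> B"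
    using minimal_vector_shortest_elements_bounded[OF v, of C] by blast
  have "\<exists>g\<in>Ogroup S. f j = act ks g v \<and> norm g \<le> B" for j
  proof -
    obtain g where g: "g \<in> Ogroup S" "f j = act ks g v" using f by (auto simp: orbit_def)
    obtain h where h: "h \<in> Ogroup S" "act ks h v = act ks g v"
      "\<And>h'. h' \<in> Ogroup S \<Longrightarrow> act ks h' v = act ks h v \<Longrightarrow> norm h \<le> norm h'"
      using shortest_group_element[OF g(1)] by metis
    then have "norm h \<le> B" using B[of h] C[of j] g(2) by simp
    then show ?thesis using h g by (intro bexI[of _ h]) simp_all
  qed
  then obtain g where g: "\<And>j. g j \<in> Ogroup S" "\<And>j. f j = act ks (g j) v" "\<And>j. norm (g j) \<le> B"
    by metis
  have "bounded (range g)" using g(3) by (auto simp: bounded_iff)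
  then obtain g0 r where r: "strict_mono (r :: nat \<Rightarrow> nat)" "(g \<circ> r) \<longlonglongrightarrow> g0"
    using bounded_imp_convergent_subsequence by blast
  then have g0: "g0 \<in> Ogroup S" using Ogroup_limit[of "g \<circ> r"] g(1) by simp
  have "tconv ks (\<lambda>j. act ks ((g \<circ> r) j) v) (act ks g0 v)"
    by (intro tconv_act tconv_const r)
  moreover have "tconv ks (\<lambda>j. act ks ((g \<circ> r) j) v) Y"
    using tconv_subseq[OF fY r(1)] by (simp add: o_def g(2))
  ultimately have "Y = act ks g0 v" using tconv_unique Y act_in_tspace by blast
  then show "Y \<in> orbit ks S v" using g0 by (auto simp: orbit_def)
qed

section \<open>Minimal vectors in orbit closures and the approximation theorem\<close>

lemma minimal_vector_in_orbit_closure: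
  assumes X: "X \<in> tspace ks"
  obtains M Y where "minimal_vector ks S Y" "\<And>j. M j \<in> Ogroup S" "tconv ks (\<lambda>j. act ks (M j) X) Y"
proof -
  define N where "N = (\<lambda>M. tnorm ks (act ks M X)) ` Ogroup S"
  have N: "N \<noteq> {}" "bdd_below N" using mat_1_Ogroup by (auto simp: N_def intro!: bdd_belowI2[of _ 0])
  have "\<exists>M\<in>Ogroup S. tnorm ks (act ks M X) < Inf N + 1 / real (Suc j)" for j
    using cInf_lessD[OF N(1), of "Inf N + 1 / real (Suc j)"] by (auto simp: N_def)
  then obtain M where M: "\<And>j. M j \<in> Ogroup S" "\<And>j. tnorm ks (act ks (M j) X) < Inf N + 1 / real (Suc j)"
    by metis
  have "1 / real (Suc j) \<le> 1" for j by simp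
  then have "tnorm ks (act ks (M j) X) \<le> Inf N + 1" for j
    using M(2)[of j] by (meson add_left_mono less_imp_le order.trans)
  then obtain r Y where r: "strict_mono r" "Y \<in> tspace ks" "tconv ks ((\<lambda>j. act ks (M j) X) \<circ> r) Y"
    by (rule bounded_tdata_convergent_subseq)
  then have conv: "tconv ks (\<lambda>j. act ks (M (r j)) X) Y" by (simp add: o_def)
  have "(\<lambda>j. Inf N + 1 / real (Suc (r j))) \<longlonglongrightarrow> Inf N + 0"
    using LIMSEQ_subseq_LIMSEQ[OF LIMSEQ_inverse_real_of_nat r(1)]
    by (intro tendsto_intros) (simp add: o_def inverse_eq_divide)
  then have le: "tnorm ks Y \<le> Inf N"
    using tconv_tnorm[OF conv] M(2) by (intro LIMSEQ_le[where Y = "\<lambda>j. Inf N + 1 / real (Suc (r j))"]) (auto intro: less_imp_le)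
  \<comment> \<open>The vector \<open>act ks g Y\<close> is again a limit of points in the orbit of
    \<open>X\<close>, given by \<open>M (r j) ** g\<close>, and each of these has norm at least
    \<open>Inf N\<close>.\<close>
  have "Inf N \<le> tnorm ks (act ks g Y)" if g: "g \<in> Ogroup S" for g
  proof (rule LIMSEQ_le_const)
    show "(\<lambda>j. tnorm ks (act ks g (act ks (M (r j)) X))) \<longlonglongrightarrow> tnorm ks (act ks g Y)"
      by (intro tconv_tnorm tconv_act conv tendsto_const)
    have "Inf N \<le> tnorm ks (act ks g (act ks (M (r j)) X))" for j
      using cInf_lower[OF _ N(2)] Ogroup_mult[OF M(1) g] by (auto simp: act_act N_def)
    then show "\<exists>n. \<forall>j\<ge>n. Inf N \<le> tnorm ks (act ks g (act ks (M (r j)) X))" by blast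
  qed
  then have "minimal_vector ks S Y"
    using le r(2) by (force simp: minimal_vector_def intro: order.trans)
  then show ?thesis using that[OF _ _ conv] M(1) by blast
qed

theorem theorem3:
  fixes k :: nat and S :: "'n::finite set" and X :: "'n tdata"
  defines "ks \<equiv> curv_ranks k"
  assumes "X \<in> tspace ks"
  shows "char_by_invariants ks S X \<or>
    (\<forall>\<epsilon>>0. \<exists>M\<in>Ogroup S. \<exists>Xt\<in>tspace ks.
        tnorm ks (\<lambda>i l. act ks M X i l - Xt i l) < \<epsilon> \<and>
        char_by_invariants ks S Xt \<and>
        (\<forall>I\<in>poly_invariants ks S. I Xt = I (act ks M X)))"
proof (intro disjI2 allI impI)
  fix \<epsilon> :: real assume "\<epsilon> > 0"
  \<comment> \<open>\<open>Y\<close> serves as \<open>Xt\<close> and is obtained without reference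
    to \<open>\<epsilon>\<close>; only the choice of the frame change \<open>M j\<close> depends on
    \<open>\<epsilon>\<close>.\<close>
  obtain M Y where Y: "minimal_vector ks S Y" and M: "\<And>j. M j \<in> Ogroup S"
    and conv: "tconv ks (\<lambda>j. act ks (M j) X) Y"
    using minimal_vector_in_orbit_closure[OF assms(2)] by metis
  have "\<forall>\<^sub>F j in sequentially. tnorm ks (\<lambda>i l. act ks (M j) X i l - Y i l) < \<epsilon>"
    using conv \<open>\<epsilon> > 0\<close> unfolding tconv_iff_tnorm by (rule order_tendstoD)
  then obtain j where j: "tnorm ks (\<lambda>i l. act ks (M j) X i l - Y i l) < \<epsilon>"
    by (auto simp: eventually_sequentially)
  have "I Y = I (act ks (M j) X)" if I: "I \<in> poly_invariants ks S" for I
  proof -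
    have "I (act ks (M i) X) = I X" for i
      using I M assms(2) by (simp add: poly_invariants_def)
    moreover have "(\<lambda>i. I (act ks (M i) X)) \<longlonglongrightarrow> I Y"
      using I conv by (intro tconv_poly_fun) (auto simp: poly_invariants_def)
    ultimately show ?thesis by (simp add: LIMSEQ_const_iff)
  qed
  then show "\<exists>M\<in>Ogroup S. \<exists>Xt\<in>tspace ks.
      tnorm ks (\<lambda>i l. act ks M X i l - Xt i l) < \<epsilon> \<and> char_by_invariants ks S Xt \<and>
      (\<forall>I\<in>poly_invariants ks S. I Xt = I (act ks M X))"
    using M j Y minimal_vector_closed_orbit[OF Y] by (auto simp: minimal_vector_def)
qed

end
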